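(* For all positive integers $r$ and $n$, $p_r(P_n)=r\,p(P_n)$.
   Context: $P_n$ is the path with $n$ vertices. An edge-coloring of a graph $G$ is any assignment of colors to its edges. A parity walk (in an edge-coloring) is a walk along which every color is used an even number of times. A parity path is a parity walk that is a path with at least one edge. A parity edge-coloring is an edge-coloring having no parity path, and $p(G)$ is the minimum number of colors in a parity edge-coloring of $G$. A parity $r$-set edge-coloring of $G$ is an assignment of a set of $r$ colors to each edge of $G$ so that every selection of one color from the set on each edge yields a parity edge-coloring of $G$. $p_r(G)$ is the minimum size of the union of the color sets in a parity $r$-set edge-coloring of $G$. *)

theory Defs
  imports Main
begin

text \<open>
  An undirected graph has a vertex set and a set of edges; an edge is the unordered pair
  of its endpoints. An edge-colouring is a function on vertex sets, of which only
  the values on edges matter.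
\<close>

record 'a graph =
  verts :: "'a set"
  edges :: "'a set set"

definition simple_graph :: "'a graph \<Rightarrow> bool" where
  "simple_graph G \<longleftrightarrow> (\<forall>e \<in> edges G. e \<subseteq> verts G \<and> card e = 2)"

definition path_graph :: "nat \<Rightarrow> nat graph" where
  "path_graph n = \<lparr>verts = {0..<n}, edges = {{i, Suc i} | i. Suc i < n}\<rparr>"

lemma simple_graph_path_graph: "simple_graph (path_graph n)"
  by (auto simp: simple_graph_def path_graph_def)

lemma finite_edges_path_graph: "finite (edges (path_graph n))"
proof -
  have "edges (path_graph n) = (\<lambda>i. {i, Suc i}) ` {i. Suc i < n}"
    by (auto simp: path_graph_def)
  moreover have "finite {i. Suc i < n}"
    by (rule finite_subset[of _ "{..<n}"]) auto
  ultimately show ?thesis by simp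
qed

text \<open>Walks are given by their vertex sequences.\<close>

fun walk_edges :: "'a list \<Rightarrow> 'a set list" where
  "walk_edges (u # v # vs) = {u, v} # walk_edges (v # vs)"
| "walk_edges _ = []"

definition walk :: "'a graph \<Rightarrow> 'a list \<Rightarrow> bool" where
  "walk G vs \<longleftrightarrow> vs \<noteq> [] \<and> set vs \<subseteq> verts G \<and> set (walk_edges vs) \<subseteq> edges G"

text \<open>Edges traversed several times are counted with multiplicity.\<close>

definition parity_walk :: "'a graph \<Rightarrow> ('a set \<Rightarrow> 'c) \<Rightarrow> 'a list \<Rightarrow> bool" where
  "parity_walk G c vs \<longleftrightarrow>
     walk G vs \<and> (\<forall>k. even (count_list (map c (walk_edges vs)) k))"

definition parity_path :: "'a graph \<Rightarrow> ('a set \<Rightarrow> 'c) \<Rightarrow> 'a list \<Rightarrow> bool" where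
  "parity_path G c vs \<longleftrightarrow> parity_walk G c vs \<and> distinct vs \<and> walk_edges vs \<noteq> []"

definition parity_edge_coloring :: "'a graph \<Rightarrow> ('a set \<Rightarrow> 'c) \<Rightarrow> bool" where
  "parity_edge_coloring G c \<longleftrightarrow> (\<nexists>vs. parity_path G c vs)"

definition parity_set_edge_coloring :: "nat \<Rightarrow> 'a graph \<Rightarrow> ('a set \<Rightarrow> 'c set) \<Rightarrow> bool" where
  "parity_set_edge_coloring r G S \<longleftrightarrow>
     (\<forall>e \<in> edges G. finite (S e) \<and> card (S e) = r) \<and>
     (\<forall>c. (\<forall>e \<in> edges G. c e \<in> S e) \<longrightarrow> parity_edge_coloring G c)"

text \<open>
  The two parameters are meant for graphs with finitely many edges. Natural numbers serve as
  colours, so that the supply of colours is unlimited; only the colours occurring on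
  edges are counted.
\<close>

definition parity_number :: "'a graph \<Rightarrow> nat" where
  "parity_number G =
     (LEAST k. \<exists>c :: 'a set \<Rightarrow> nat. parity_edge_coloring G c \<and> card (c ` edges G) = k)"

definition set_parity_number :: "nat \<Rightarrow> 'a graph \<Rightarrow> nat" where
  "set_parity_number r G =
     (LEAST k. \<exists>S :: 'a set \<Rightarrow> nat set.
        parity_set_edge_coloring r G S \<and> card (\<Union>e \<in> edges G. S e) = k)"

end

theory Submission
  imports Defs "HOL-Library.Multiset"
begin

text \<open>
  Blowing up every colour of a parity edge-colouring to \<open>r\<close> colours gives the upper bound.
  For the lower bound, call two edges of the path related if their colour sets intersect. By the
  Gallai--Milgram theorem for the left-to-right order, the edges can be partitioned into \<open>t\<close>
  increasing sequences in which consecutive edges are related, and there are \<open>t\<close> pairwise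
  unrelated edges, so at least \<open>r t\<close> colours are used. Colouring each edge by the index
  of its sequence yields a parity edge-colouring with \<open>t\<close> colours: if a subpath met every
  sequence an even number of times, then it could be split into pairs of consecutive members of
  a sequence, and choosing a common colour for each pair would select a parity path.
\<close>

section \<open>The Gallai--Milgram theorem for ordered sets\<close>

text \<open>
  A partition into directed paths is encoded by a function \<open>f\<close> whose fibres on \<open>V\<close> are
  the paths, listed in increasing order.
\<close>

definition path_partition :: "('a::linorder \<Rightarrow> 'a \<Rightarrow> bool) \<Rightarrow> ('a \<Rightarrow> 'c) \<Rightarrow> 'a set \<Rightarrow> bool" where
  "path_partition R f V \<longleftrightarrow>
     (\<forall>x\<in>V. \<forall>y\<in>V. x < y \<and> f x = f y \<and> (\<forall>z\<in>V. x < z \<and> z < y \<longrightarrow> f z \<noteq> f x) \<longrightarrow> R x y)"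

definition terminals :: "('a::linorder \<Rightarrow> 'c) \<Rightarrow> 'a set \<Rightarrow> 'a set" where
  "terminals f V = {x \<in> V. \<forall>y\<in>V. x < y \<longrightarrow> f y \<noteq> f x}"

section \<open>Deleting and reattaching a vertex of a path partition\<close>

lemma path_partitionD:
  assumes "path_partition R f V" "x \<in> V" "y \<in> V" "x < y" "f x = f y"
    and "\<And>z. z \<in> V \<Longrightarrow> x < z \<Longrightarrow> z < y \<Longrightarrow> f z \<noteq> f x"
  shows "R x y"
  using assms unfolding path_partition_def by blast

lemma path_partition_inj: "inj_on f V \<Longrightarrow> path_partition R f V"
  unfolding path_partition_def inj_on_def by blast

text \<open>A terminal never lies between two other members of its own fibre, so deleting it creates
  no new consecutive pair.\<close>

lemma path_partition_remove_terminal: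
  assumes "path_partition R f V" "y \<in> terminals f V"
  shows "path_partition R f (V - {y})"
  unfolding path_partition_def
proof (intro ballI impI, elim conjE)
  fix u v
  assume u: "u \<in> V - {y}" and v: "v \<in> V - {y}" and "u < v" "f u = f v"
    and gap: "\<forall>z\<in>V - {y}. u < z \<and> z < v \<longrightarrow> f z \<noteq> f u"
  moreover have "f y \<noteq> f u" if "y < v"
    using assms(2) that v \<open>f u = f v\<close> by (auto simp: terminals_def)
  ultimately show "R u v"
    by (intro path_partitionD[OF assms(1)]) blast+
qed

text \<open>The only consecutive pair created is \<open>z\<close>, \<open>y\<close>. Vertices above
  \<open>y\<close> may exist, but none of them lies in the fibre of \<open>z\<close>, because
  \<open>z\<close> is terminal.\<close>

lemma path_partition_append:
  assumes "path_partition R g (V - {y})" "z \<in> terminals g (V - {y})" "z < y" "R z y"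
  shows "path_partition R (g(y := g z)) V"
  unfolding path_partition_def
proof (intro ballI impI, elim conjE)
  fix u v
  let ?h = "g(y := g z)"
  assume u: "u \<in> V" and v: "v \<in> V" and uv: "u < v" and eq: "?h u = ?h v"
    and gap: "\<forall>w\<in>V. u < w \<and> w < v \<longrightarrow> ?h w \<noteq> ?h u"
  have z: "z \<in> V" "z \<noteq> y" and last: "\<And>w. w \<in> V \<Longrightarrow> w \<noteq> y \<Longrightarrow> z < w \<Longrightarrow> g w \<noteq> g z"
    using assms(2) by (auto simp: terminals_def)
  consider "u = y" | "v = y" "u \<noteq> y" | "u \<noteq> y" "v \<noteq> y" by blast
  then show "R u v"
  proof cases
    case 1
    then have "g v = g z" "v \<noteq> y" using eq uv by (auto split: if_splits)
    then show ?thesis using last[OF v] uv 1 assms(3) by auto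
  next
    case 2
    then have "g u = g z" using eq by auto
    then have "\<not> z < u" using last[OF u] 2 by auto
    moreover have "\<not> u < z" using gap z assms(3) 2 \<open>g u = g z\<close> by auto
    ultimately show ?thesis using 2 assms(4) by auto
  next
    case 3
    then have eq': "g u = g v" using eq by simp
    show ?thesis
    proof (rule path_partitionD[OF assms(1)])
      fix w assume "w \<in> V - {y}" "u < w" "w < v"
      then show "g w \<noteq> g u" using gap 3 by auto
    qed (use u v uv eq' 3 in auto)
  qed
qed

lemma inj_on_terminals: "inj_on f (terminals f V)"
proof (rule inj_onI)
  fix x y assume "x \<in> terminals f V" "y \<in> terminals f V" "f x = f y"
  then show "x = y" by (cases x y rule: linorder_cases) (auto simp: terminals_def)
qed

lemma terminals_append:
  assumes "y \<in> V" "z \<in> terminals g (V - {y})" "z < y"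
  shows "terminals (g(y := g z)) V = insert y (terminals g (V - {y}) - {z})"
proof (rule set_eqI)
  fix w
  have z: "z \<in> V" "z \<noteq> y" and last: "\<And>v. v \<in> V \<Longrightarrow> v \<noteq> y \<Longrightarrow> z < v \<Longrightarrow> g v \<noteq> g z"
    using assms(2) by (auto simp: terminals_def)
  consider "w = y" | "w = z" | "w \<noteq> y" "w \<noteq> z" by blast
  then show "w \<in> terminals (g(y := g z)) V \<longleftrightarrow> w \<in> insert y (terminals g (V - {y}) - {z})"
  proof cases
    case 1
    have "(g(y := g z)) v \<noteq> g z" if "v \<in> V" "y < v" for v
      using last[of v] that assms(3) by auto
    then show ?thesis using 1 assms(1) by (auto simp: terminals_def)
  next
    case 2
    then show ?thesis using z assms by (auto simp: terminals_def)
  next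
    case 3
    have "g z \<noteq> g w" if "w \<in> terminals g (V - {y})"
      using that 3 assms(2) inj_onD[OF inj_on_terminals] by metis
    then show ?thesis using 3 by (auto simp: terminals_def)
  qed
qed

lemma path_partition_fresh:
  assumes "path_partition R g (V - {y})" "a \<notin> g ` V"
  shows "path_partition R (g(y := a)) V"
  unfolding path_partition_def
proof (intro ballI impI, elim conjE)
  fix u v
  let ?h = "g(y := a)"
  assume u: "u \<in> V" and v: "v \<in> V" and uv: "u < v" and eq: "?h u = ?h v"
    and gap: "\<forall>w\<in>V. u < w \<and> w < v \<longrightarrow> ?h w \<noteq> ?h u"
  have ne: "u \<noteq> y" "v \<noteq> y" using u v uv eq assms(2) by (auto split: if_splits)
  show "R u v"
  proof (rule path_partitionD[OF assms(1)])
    fix w assume "w \<in> V - {y}" "u < w" "w < v"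
    then show "g w \<noteq> g u" using gap ne by auto
  qed (use u v uv eq ne in auto)
qed

lemma terminals_fresh:
  assumes "y \<in> V" "a \<notin> g ` V"
  shows "terminals (g(y := a)) V = insert y (terminals g (V - {y}))"
  using assms by (auto simp: terminals_def)

lemma terminal_exists:
  assumes "finite V" "x \<in> V"
  obtains t where "t \<in> terminals f V" "f t = f x"
proof -
  let ?C = "{v \<in> V. f v = f x}"
  have "finite ?C" "?C \<noteq> {}" using assms by auto
  then have "Max ?C \<in> ?C" and "\<And>w. w \<in> ?C \<Longrightarrow> w \<le> Max ?C"
    by (auto intro: Max_in simp del: mem_Collect_eq)
  then show thesis using that[of "Max ?C"] by (force simp: terminals_def)
qed

lemma image_terminals:
  assumes "finite V"
  shows "f ` terminals f V = f ` V"
proof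
  show "f ` V \<subseteq> f ` terminals f V"
    using terminal_exists[OF assms] by (metis image_eqI image_subsetI)
qed (auto simp: terminals_def)

text \<open>A fibre has at most one terminal, so in the fibre of \<open>y\<close> it changes from
  \<open>y\<close> to \<open>t\<close>; the other fibres are unaffected.\<close>

lemma terminals_remove:
  assumes "y \<in> terminals f V" "t \<in> terminals f (V - {y})" "f t = f y"
  shows "terminals f (V - {y}) = insert t (terminals f V - {y})"
proof (rule set_eqI)
  fix w
  show "w \<in> terminals f (V - {y}) \<longleftrightarrow> w \<in> insert t (terminals f V - {y})"
  proof (cases "f w = f y")
    case True
    then have "w \<in> terminals f (V - {y}) \<longleftrightarrow> w = t" "w \<in> terminals f V \<longleftrightarrow> w = y"
      using assms inj_onD[OF inj_on_terminals] by metis+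
    then show ?thesis using assms(2) by (auto simp: terminals_def)
  next
    case False
    then show ?thesis using assms(3) by (auto simp: terminals_def)
  qed
qed

text \<open>The inductive core of Gallai--Milgram. Shrinking the terminal set by inclusion, not just
  in size, lets the induction hypothesis control where a deleted vertex can be reattached. Indices
  in \<open>nat\<close> leave a fresh one for a new path.\<close>

lemma path_partition_improve:
  fixes f :: "'a::linorder \<Rightarrow> nat"
  assumes "finite V" "path_partition R f V"
  shows "(\<exists>g::'a \<Rightarrow> nat. path_partition R g V \<and> terminals g V \<subset> terminals f V) \<or>
    (\<exists>I \<subseteq> V. (\<forall>x\<in>I. \<forall>y\<in>I. x < y \<longrightarrow> \<not> R x y) \<and> card I = card (f ` V))"
  using assms
proof (induction V arbitrary: f rule: finite_psubset_induct)
  case (psubset V)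
  show ?case
  proof (cases "\<exists>x\<in>terminals f V. \<exists>y\<in>terminals f V. x < y \<and> R x y")
    case False
    \<comment> \<open>Each path has exactly one terminal, so pairwise unrelated terminals already
      form the independent set.\<close>
    have "card (terminals f V) = card (f ` V)"
      using card_image[OF inj_on_terminals[of f V]] image_terminals[OF psubset.hyps(1), of f] by simp
    then show ?thesis
      using False by (intro disjI2 exI[of _ "terminals f V"]) (auto simp: terminals_def)
  next
    case True
    then obtain x y where x: "x \<in> terminals f V" and y: "y \<in> terminals f V"
      and xy: "x < y" "R x y" by blast
    let ?W = "V - {y}"
    have yV: "y \<in> V" and WV: "?W \<subset> V" and fin: "finite ?W"
      using y psubset.hyps(1) by (auto simp: terminals_def)
    have fW: "path_partition R f ?W"
      by (rule path_partition_remove_terminal[OF psubset.prems y])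
    have xW: "x \<in> terminals f ?W"
      using x xy by (auto simp: terminals_def)
    show ?thesis
    proof (cases "\<exists>u\<in>?W. f u = f y")
      case False
      \<comment> \<open>Here \<open>y\<close> is a path by itself, so appending it to the path of
        \<open>x\<close> removes \<open>x\<close> from the terminals.\<close>
      then have "terminals f ?W = terminals f V - {y}"
        by (fastforce simp: terminals_def)
      then have "terminals (f(y := f x)) V \<subset> terminals f V"
        using terminals_append[OF yV xW xy(1)] x y xy(1) by auto
      then show ?thesis
        using path_partition_append[OF fW xW xy] by blast
    next
      case True
      \<comment> \<open>\<open>t\<close> is the predecessor of \<open>y\<close> on its path, hence
        related to \<open>y\<close>.\<close>
      then obtain t where t: "t \<in> terminals f ?W" "f t = f y"
        using terminal_exists[OF fin] by metis
      have terW: "terminals f ?W = insert t (terminals f V - {y})"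
        by (rule terminals_remove[OF y t])
      have tV: "t \<in> V" "t < y"
        using t y by (auto simp: terminals_def not_less_iff_gr_or_eq)
      have Rty: "R t y"
      proof (rule path_partitionD[OF psubset.prems tV(1) yV tV(2) t(2)])
        fix z assume "z \<in> V" "t < z" "z < y"
        then show "f z \<noteq> f t" using t(1) by (auto simp: terminals_def)
      qed
      \<comment> \<open>Deleting \<open>y\<close> does not change the number of paths, so an
        independent set found in \<open>?W\<close> serves for \<open>V\<close>.\<close>
      have imW: "f ` ?W = f ` V"
        using True yV by (metis image_insert insert_Diff insert_absorb)
      from psubset.IH[OF WV fW] show ?thesis
      proof (elim disjE exE conjE)
        fix I assume "I \<subseteq> ?W" "\<forall>x\<in>I. \<forall>y\<in>I. x < y \<longrightarrow> \<not> R x y" "card I = card (f ` ?W)"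
        then show ?thesis
          unfolding imW by (intro disjI2 exI[of _ I]) auto
      next
        fix g :: "'a \<Rightarrow> nat"
        assume g: "path_partition R g ?W" and sub: "terminals g ?W \<subset> terminals f ?W"
        \<comment> \<open>Reattach \<open>y\<close> after \<open>t\<close>, else after
          \<open>x\<close>, else as a new path. In the first case strictness is inherited from
          \<open>sub\<close>; in the other two the new terminal set omits \<open>x\<close>.\<close>
        consider "t \<in> terminals g ?W" | "t \<notin> terminals g ?W" "x \<in> terminals g ?W"
          | "t \<notin> terminals g ?W" "x \<notin> terminals g ?W" by blast
        then show ?thesis
        proof cases
          case 1
          have "terminals (g(y := g t)) V \<subset> terminals f V"
            using terminals_append[OF yV 1 tV(2)] sub terW 1 y tV by auto
          then show ?thesis
            using path_partition_append[OF g 1 tV(2) Rty] by blast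
        next
          case 2
          have "terminals (g(y := g x)) V \<subset> terminals f V"
            using terminals_append[OF yV 2(2) xy(1)] sub terW 2 x y xy by auto
          then show ?thesis
            using path_partition_append[OF g 2(2) xy] by blast
        next
          case 3
          obtain a where a: "a \<notin> g ` V"
            using psubset.hyps(1) by (meson finite_imageI ex_new_if_finite infinite_UNIV_nat)
          have "terminals (g(y := a)) V \<subset> terminals f V"
            using terminals_fresh[OF yV a] sub terW 3 x y xy by auto
          then show ?thesis
            using path_partition_fresh[OF g a] by blast
        qed
      qed
    qed
  qed
qed

text \<open>One-vertex paths show that path partitions exist; one with the fewest terminals cannot
  be improved, which leaves the independent set.\<close>

theorem gallai_milgram:
  fixes V :: "'a::linorder set"
  assumes "finite V"
  obtains f :: "'a \<Rightarrow> nat" and I where "path_partition R f V" "I \<subseteq> V"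
    "\<And>x y. x \<in> I \<Longrightarrow> y \<in> I \<Longrightarrow> x < y \<Longrightarrow> \<not> R x y" "card I = card (f ` V)"
proof -
  let ?P = "\<lambda>f::'a \<Rightarrow> nat. path_partition R f V"
  obtain f0 :: "'a \<Rightarrow> nat" where "inj_on f0 V"
    using finite_imp_inj_to_nat_seg[OF assms] by blast
  then have "?P f0" by (rule path_partition_inj)
  then obtain f where f: "?P f"
    and min: "\<And>g. ?P g \<Longrightarrow> card (terminals f V) \<le> card (terminals g V)"
    using ex_has_least_nat[of ?P f0 "\<lambda>f. card (terminals f V)"] by blast
  have "finite (terminals f V)"
    using assms by (auto simp: terminals_def)
  then have "\<not> (\<exists>g. ?P g \<and> terminals g V \<subset> terminals f V)"
    using min psubset_card_mono by (metis linorder_not_less)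
  then show thesis
    using path_partition_improve[OF assms f] that[OF f] by metis
qed

section \<open>Selections along a path partition\<close>

text \<open>Peel off pairs from the top: the largest element and its predecessor in the same fibre
  have a common colour, which both receive. The rest satisfies the same hypotheses.\<close>

lemma even_selection:
  fixes J :: "'a::linorder set" and S :: "'a \<Rightarrow> 'c set"
  assumes "finite J" "path_partition (\<lambda>x y. S x \<inter> S y \<noteq> {}) f J"
    and "\<And>k. even (card {x \<in> J. f x = k})"
  shows "\<exists>s. (\<forall>x\<in>J. s x \<in> S x) \<and> (\<forall>k. even (card {x \<in> J. s x = k}))"
  using assms
proof (induction J rule: finite_psubset_induct)
  case (psubset J)
  show ?case
  proof (cases "J = {}")
    case False
    define x where "x = Max J"
    have x: "x \<in> J" "\<And>w. w \<in> J \<Longrightarrow> w \<le> x"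
      using psubset.hyps False by (auto simp: x_def)
    then have xt: "x \<in> terminals f J" by (auto simp: terminals_def leD)
    \<comment> \<open>A singleton fibre would have odd size, so \<open>x\<close> has a predecessor
      in its fibre.\<close>
    have "{w \<in> J. f w = f x} \<noteq> {x}"
      using psubset.prems(2)[of "f x"] by auto
    then obtain w where "w \<in> J - {x}" "f w = f x" using x by blast
    then obtain t where t: "t \<in> terminals f (J - {x})" "f t = f x"
      using terminal_exists[of "J - {x}" w f] psubset.hyps by auto
    have tJ: "t \<in> J" "t \<noteq> x" "t < x"
      using t x(2)[of t] by (auto simp: terminals_def)
    have "S t \<inter> S x \<noteq> {}"
    proof (rule path_partitionD[OF psubset.prems(1) tJ(1) x(1) tJ(3) t(2)])
      fix z assume "z \<in> J" "t < z" "z < x"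
      then show "f z \<noteq> f t" using t(1) by (auto simp: terminals_def)
    qed
    then obtain a where a: "a \<in> S t" "a \<in> S x" by blast
    let ?K = "J - {x} - {t}"
    \<comment> \<open>Needed twice: with \<open>f\<close> to pass evenness down to
      \<open>?K\<close>, and with the extended selection to bring it back up.\<close>
    have split: "card {w \<in> J. h w = k} = card {w \<in> ?K. h w = k} + (if h x = k then 2 else 0)"
      if "h t = h x" for h :: "'a \<Rightarrow> 'd" and k
    proof (cases "h x = k")
      case True
      then have "{w \<in> J. h w = k} = insert x (insert t {w \<in> ?K. h w = k})"
        using that tJ x by auto
      then show ?thesis using True psubset.hyps tJ by simp
    next
      case False
      then have "{w \<in> J. h w = k} = {w \<in> ?K. h w = k}"
        using that by auto
      then show ?thesis using False by simp
    qed
    \<comment> \<open>\<open>x\<close> is terminal in \<open>J\<close>, and \<open>t\<close> is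
      terminal once \<open>x\<close> is gone.\<close>
    have "path_partition (\<lambda>x y. S x \<inter> S y \<noteq> {}) f ?K"
      by (intro path_partition_remove_terminal psubset.prems xt t)
    moreover have "even (card {w \<in> ?K. f w = k})" for k
      using psubset.prems(2)[of k] split[OF t(2), of k] by (auto split: if_splits)
    ultimately obtain s where s: "\<forall>w\<in>?K. s w \<in> S w" "\<And>k. even (card {w \<in> ?K. s w = k})"
      using psubset.IH[of ?K] tJ by blast
    let ?s = "s(x := a, t := a)"
    have "{w \<in> ?K. ?s w = k} = {w \<in> ?K. s w = k}" for k by auto
    then have "even (card {w \<in> J. ?s w = k})" for k
      using split[of ?s k] s(2)[of k] by (simp split: if_splits)
    moreover have "\<forall>w\<in>J. ?s w \<in> S w" using s(1) a by auto
    ultimately show ?thesis by blast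
  qed auto
qed

section \<open>Parity edge-colourings of paths\<close>

lemma walk_edges_Cons: "vs \<noteq> [] \<Longrightarrow> walk_edges (u # vs) = {u, hd vs} # walk_edges vs"
  by (cases vs) auto

lemma walk_edges_snoc: "vs \<noteq> [] \<Longrightarrow> walk_edges (vs @ [u]) = walk_edges vs @ [{last vs, u}]"
  by (induction vs rule: walk_edges.induct) auto

lemma walk_edges_rev: "walk_edges (rev vs) = rev (walk_edges vs)"
proof (induction vs)
  case (Cons u vs)
  then show ?case
    by (cases "vs = []") (simp_all add: walk_edges_Cons walk_edges_snoc last_rev insert_commute)
qed simp

lemma walk_edges_upt: "walk_edges [a..<Suc b] = map (\<lambda>i. {i, Suc i}) [a..<b]"
proof (induction b)
  case (Suc b)
  show ?case
  proof (cases "a \<le> b")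
    case True
    then have "[a..<Suc (Suc b)] = [a..<Suc b] @ [Suc b]" "last [a..<Suc b] = b" "[a..<Suc b] \<noteq> []"
      by simp_all
    then have "walk_edges [a..<Suc (Suc b)] = walk_edges [a..<Suc b] @ [{b, Suc b}]"
      by (simp only: walk_edges_snoc not_False_eq_True)
    then show ?thesis using Suc True by simp
  qed (auto simp: le_Suc_eq)
qed auto

section \<open>Paths inside a path graph and their colour counts\<close>

lemma edges_path_graph: "edges (path_graph n) = (\<lambda>i. {i, Suc i}) ` {..<n - 1}"
  by (auto simp: path_graph_def)

lemma path_graph_edge_iff: "{u, v} \<in> edges (path_graph n) \<longleftrightarrow> u < n \<and> v < n \<and> (v = Suc u \<or> u = Suc v)"
  by (auto simp: path_graph_def doubleton_eq_iff)

text \<open>Distinctness forbids turning back, so a path keeps the direction of its first step. A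
  single vertex fits both forms.\<close>

lemma distinct_walk_path_graph:
  assumes "walk (path_graph n) vs" "distinct vs"
  shows "\<exists>a b. a \<le> b \<and> b < n \<and> (vs = [a..<Suc b] \<or> vs = rev [a..<Suc b])"
  using assms
proof (induction vs rule: walk_edges.induct)
  case (1 u v vs)
  have "walk (path_graph n) (v # vs)" "distinct (v # vs)"
    using "1.prems" by (auto simp: walk_def)
  then obtain a b where ab: "a \<le> b" "b < n" "v # vs = [a..<Suc b] \<or> v # vs = rev [a..<Suc b]"
    using "1.IH" by blast
  have un: "u < n" and uv: "v = Suc u \<or> u = Suc v"
    using "1.prems"(1) by (auto simp: walk_def path_graph_edge_iff)
  have "set (v # vs) = {a..b}"
    using ab(3) by (metis atLeastLessThanSuc_atLeastAtMost set_rev set_upt)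
  then have notin: "u \<notin> {a..b}" using "1.prems"(2) by auto
  from ab(3) show ?case
  proof
    assume up: "v # vs = [a..<Suc b]"
    then have "v = a" using ab(1) by (metis hd_upt le_imp_less_Suc list.sel(1))
    show ?thesis
    proof (cases "v = Suc u")
      case True
      then have "u # v # vs = [u..<Suc b]"
        using up \<open>v = a\<close> ab(1) by (simp add: upt_conv_Cons)
      then show ?thesis using True \<open>v = a\<close> ab by (intro exI[of _ u] exI[of _ b]) auto
    next
      case False
      \<comment> \<open>Stepping down onto an ascending tail is possible only if the tail is one
        vertex; otherwise \<open>Suc a\<close> would repeat.\<close>
      then have "u = Suc a" "a = b" using uv \<open>v = a\<close> notin ab(1) by auto
      then have "u # v # vs = rev [a..<Suc u]" using up by simp
      then show ?thesis using \<open>u = Suc a\<close> un by (intro exI[of _ a] exI[of _ u]) auto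
    qed
  next
    assume down: "v # vs = rev [a..<Suc b]"
    then have "v = b" using ab(1) by simp
    show ?thesis
    proof (cases "u = Suc v")
      case True
      then have "u # v # vs = rev [a..<Suc u]"
        using down \<open>v = b\<close> ab(1) by simp
      then show ?thesis using True \<open>v = b\<close> ab un by (intro exI[of _ a] exI[of _ u]) auto
    next
      case False
      then have "b = Suc u" "a = b" using uv \<open>v = b\<close> notin ab(1) by auto
      then have "u # v # vs = [u..<Suc b]" using down by (simp add: upt_conv_Cons)
      then show ?thesis using \<open>b = Suc u\<close> ab by (intro exI[of _ u] exI[of _ b]) auto
    qed
  qed
next
  case ("2_2" v)
  then show ?case by (intro exI[of _ v]) (auto simp: walk_def path_graph_def)
qed (simp add: walk_def)

lemma count_list_map_upt:
  "count_list (map h [a..<b]) k = card {i \<in> {a..<b}. h i = k}"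
proof (induction b)
  case (Suc b)
  show ?case
  proof (cases "a \<le> b")
    case True
    then have "{i \<in> {a..<Suc b}. h i = k} =
      (if h b = k then insert b {i \<in> {a..<b}. h i = k} else {i \<in> {a..<b}. h i = k})"
      by (auto simp: less_Suc_eq)
    then show ?thesis using Suc True by auto
  qed auto
qed simp

text \<open>Reversal preserves colour counts, so only ascending paths matter. Edges are indexed by
  their left endpoints, hence the range from \<open>a\<close> to \<open>b - 1\<close>.\<close>

lemma parity_edge_coloring_path_graph:
  "parity_edge_coloring (path_graph n) c \<longleftrightarrow>
     (\<forall>a b. a < b \<longrightarrow> b < n \<longrightarrow> (\<exists>k. odd (card {i \<in> {a..<b}. c {i, Suc i} = k})))"
proof -
  have count: "count_list (map c (walk_edges [a..<Suc b])) k = card {i \<in> {a..<b}. c {i, Suc i} = k}"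
    for a b k
    using count_list_map_upt[of "\<lambda>i. c {i, Suc i}" a b k] by (simp only: walk_edges_upt map_map o_def)
  have count_rev: "count_list (map c (walk_edges (rev vs))) k = count_list (map c (walk_edges vs)) k"
    for vs :: "nat list" and k
    by (simp only: walk_edges_rev rev_map[symmetric] count_list_rev)
  have upt: "parity_path (path_graph n) c [a..<Suc b]"
    if "a < b" "b < n" "\<And>k. even (card {i \<in> {a..<b}. c {i, Suc i} = k})" for a b
  proof -
    have "walk (path_graph n) [a..<Suc b]"
      unfolding walk_def walk_edges_upt using that by (auto simp: path_graph_def)
    then show ?thesis
      unfolding parity_path_def parity_walk_def count
      using that by (simp add: walk_edges_upt del: upt_Suc)
  qed
  have "\<exists>a b. a < b \<and> b < n \<and> (\<forall>k. even (card {i \<in> {a..<b}. c {i, Suc i} = k}))"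
    if "parity_path (path_graph n) c vs" for vs
  proof -
    have vs: "walk (path_graph n) vs" "distinct vs" "walk_edges vs \<noteq> []"
      and ev: "\<And>k. even (count_list (map c (walk_edges vs)) k)"
      using that by (auto simp: parity_path_def parity_walk_def)
    obtain a b where ab: "a \<le> b" "b < n" "vs = [a..<Suc b] \<or> vs = rev [a..<Suc b]"
      using distinct_walk_path_graph[OF vs(1,2)] by blast
    then have "even (card {i \<in> {a..<b}. c {i, Suc i} = k})" for k
      using ev[of k] count[of a b k] count_rev[of "[a..<Suc b]" k] by metis
    moreover have "a \<noteq> b"
      using ab(3) vs(3) by auto
    ultimately show ?thesis using ab(1,2) by (intro exI[of _ a] exI[of _ b]) auto
  qed
  then have "(\<exists>vs. parity_path (path_graph n) c vs) \<longleftrightarrow>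
      (\<exists>a b. a < b \<and> b < n \<and> (\<forall>k. even (card {i \<in> {a..<b}. c {i, Suc i} = k})))"
    using upt by blast
  then show ?thesis
    unfolding parity_edge_coloring_def by blast
qed

text \<open>Giving all edges different colours shows that the minimum in
  \<open>parity_number\<close> is attained.\<close>

lemma parity_edge_coloring_path_graph_Min: "parity_edge_coloring (path_graph n) Min"
  unfolding parity_edge_coloring_path_graph
proof (intro allI impI exI)
  fix a b :: nat
  assume "a < b"
  then have "{i \<in> {a..<b}. Min {i, Suc i} = a} = {a}" by (auto simp: min_def)
  then show "odd (card {i \<in> {a..<b}. Min {i, Suc i} = a})" by simp
qed

section \<open>The two inequalities\<close>

text \<open>After merging colours, each count is a sum of old counts.\<close>

lemma even_count_list_map:
  assumes "\<And>j. even (count_list xs j)"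
  shows "even (count_list (map g xs) k)"
proof -
  have "count_list (map g xs) k = (\<Sum>j\<in>g -` {k} \<inter> set xs. count_list xs j)"
    using count_image_mset[of g "mset xs" k] by (simp add: count_mset flip: mset_map)
  then show ?thesis using assms by (simp add: dvd_sum)
qed

text \<open>Colour \<open>k\<close> becomes the \<open>k\<close>-th block of \<open>r\<close>
  consecutive numbers. Division by \<open>r\<close> recovers \<open>c\<close> from any selection, so
  a parity path for the selection is one for \<open>c\<close>.\<close>

lemma blow_up_coloring:
  fixes c :: "'a set \<Rightarrow> nat"
  assumes "parity_edge_coloring G c"
  shows "parity_set_edge_coloring r G (\<lambda>e. {r * c e..<r * c e + r})"
  unfolding parity_set_edge_coloring_def
proof (intro conjI allI impI)
  fix s assume s: "\<forall>e\<in>edges G. s e \<in> {r * c e..<r * c e + r}"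
  have div: "s e div r = c e" if "e \<in> edges G" for e
    using s that by (intro div_nat_eqI) (auto simp: algebra_simps)
  have "parity_path G c vs" if vs: "parity_path G s vs" for vs
  proof -
    have sub: "set (walk_edges vs) \<subseteq> edges G"
      using vs by (auto simp: parity_path_def parity_walk_def walk_def)
    then have "map c (walk_edges vs) = map (\<lambda>j. j div r) (map s (walk_edges vs))"
      using div by auto
    then show ?thesis
      using vs even_count_list_map[of "map s (walk_edges vs)" "\<lambda>j. j div r"]
      unfolding parity_path_def parity_walk_def by metis
  qed
  then show "parity_edge_coloring G s"
    using assms by (auto simp: parity_edge_coloring_def)
qed auto

text \<open>A parity path for the index colouring would turn, by \<open>even_selection\<close>, into
  one for a selection from \<open>S\<close>. \<open>Min\<close> recovers the left endpoint of an
  edge.\<close>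

lemma path_index_coloring:
  fixes S :: "nat set \<Rightarrow> 'c set" and f :: "nat \<Rightarrow> 'd"
  assumes S: "parity_set_edge_coloring r (path_graph n) S"
    and nonempty: "\<And>e. e \<in> edges (path_graph n) \<Longrightarrow> S e \<noteq> {}"
    and f: "path_partition (\<lambda>i j. S {i, Suc i} \<inter> S {j, Suc j} \<noteq> {}) f {..<n - 1}"
  shows "parity_edge_coloring (path_graph n) (\<lambda>e. f (Min e))"
  unfolding parity_edge_coloring_path_graph
proof (intro allI impI, rule ccontr)
  fix a b :: nat
  assume ab: "a < b" "b < n" and "\<nexists>k. odd (card {i \<in> {a..<b}. f (Min {i, Suc i}) = k})"
  then have ev: "even (card {i \<in> {a..<b}. f i = k})" for k by (simp add: min_def)
  \<comment> \<open>Intervals are convex, so members consecutive within the interval are consecutive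
    overall.\<close>
  have "path_partition (\<lambda>i j. S {i, Suc i} \<inter> S {j, Suc j} \<noteq> {}) f {a..<b}"
    unfolding path_partition_def
  proof (intro ballI impI, elim conjE)
    fix i j
    assume "i \<in> {a..<b}" "j \<in> {a..<b}" "i < j" "f i = f j"
      "\<forall>z\<in>{a..<b}. i < z \<and> z < j \<longrightarrow> f z \<noteq> f i"
    then show "S {i, Suc i} \<inter> S {j, Suc j} \<noteq> {}"
      using ab by (intro path_partitionD[OF f]) auto
  qed
  then obtain s where s: "\<And>i. i \<in> {a..<b} \<Longrightarrow> s i \<in> S {i, Suc i}"
    "\<And>k. even (card {i \<in> {a..<b}. s i = k})"
    using even_selection[of "{a..<b}" "\<lambda>i. S {i, Suc i}" f] ev by blast
  \<comment> \<open>Off the interval any member of \<open>S e\<close> will do; it only makes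
    \<open>c\<close> a selection on all edges.\<close>
  define c where "c e = (if Min e \<in> {a..<b} then s (Min e) else SOME x. x \<in> S e)" for e
  have "c e \<in> S e" if e: "e \<in> edges (path_graph n)" for e
  proof -
    obtain i where "e = {i, Suc i}" using e by (auto simp: edges_path_graph)
    then show ?thesis
      using s(1)[of i] nonempty[OF e] by (auto simp: c_def min_def some_in_eq)
  qed
  then have "parity_edge_coloring (path_graph n) c"
    using S by (auto simp: parity_set_edge_coloring_def)
  then obtain k where "odd (card {i \<in> {a..<b}. c {i, Suc i} = k})"
    using ab unfolding parity_edge_coloring_path_graph by blast
  moreover have "{i \<in> {a..<b}. c {i, Suc i} = k} = {i \<in> {a..<b}. s i = k}"
    by (auto simp: c_def min_def)
  ultimately show False using s(2) by simp
qed

lemma set_coloring_lower_bound: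
  fixes S :: "nat set \<Rightarrow> 'c set"
  assumes "r \<ge> 1" and S: "parity_set_edge_coloring r (path_graph n) S"
  obtains c :: "nat set \<Rightarrow> nat" where "parity_edge_coloring (path_graph n) c"
    "r * card (c ` edges (path_graph n)) \<le> card (\<Union>e\<in>edges (path_graph n). S e)"
proof -
  let ?E = "edges (path_graph n)"
  let ?R = "\<lambda>i j. S {i, Suc i} \<inter> S {j, Suc j} \<noteq> {}"
  have Se: "finite (S e)" "card (S e) = r" if "e \<in> ?E" for e
    using S that by (auto simp: parity_set_edge_coloring_def)
  obtain f :: "nat \<Rightarrow> nat" and I where f: "path_partition ?R f {..<n - 1}" and I: "I \<subseteq> {..<n - 1}"
    and indep: "\<And>i j. i \<in> I \<Longrightarrow> j \<in> I \<Longrightarrow> i < j \<Longrightarrow> \<not> ?R i j"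
    and card: "card I = card (f ` {..<n - 1})"
    by (rule gallai_milgram[OF finite_lessThan[of "n - 1"], of ?R]) (rule that)
  have IE: "{i, Suc i} \<in> ?E" if "i \<in> I" for i
    using that I by (auto simp: edges_path_graph)
  have "card (\<Union>i\<in>I. S {i, Suc i}) = (\<Sum>i\<in>I. card (S {i, Suc i}))"
  proof (rule card_UN_disjoint)
    show "finite I" using I finite_subset by blast
    show "\<forall>i\<in>I. finite (S {i, Suc i})" using Se IE by blast
    \<comment> \<open>Intersecting is symmetric, so independence for \<open>i < j\<close> covers
      both orders.\<close>
    show "\<forall>i\<in>I. \<forall>j\<in>I. i \<noteq> j \<longrightarrow> S {i, Suc i} \<inter> S {j, Suc j} = {}"
      using indep by (metis Int_commute linorder_neqE)
  qed
  also have "\<dots> = r * card I" using Se(2) IE by simp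
  finally have "r * card I = card (\<Union>i\<in>I. S {i, Suc i})" ..
  also have "\<dots> \<le> card (\<Union>e\<in>?E. S e)"
    using IE Se(1) finite_edges_path_graph by (intro card_mono) auto
  also have "(\<lambda>e. f (Min e)) ` ?E = f ` {..<n - 1}"
    by (simp add: edges_path_graph image_image min_def)
  then have "card I = card ((\<lambda>e. f (Min e)) ` ?E)" using card by simp
  finally have "r * card ((\<lambda>e. f (Min e)) ` ?E) \<le> card (\<Union>e\<in>?E. S e)" .
  \<comment> \<open>Here \<open>r \<ge> 1\<close> enters: selections must exist.\<close>
  moreover have "S e \<noteq> {}" if "e \<in> ?E" for e using Se(2)[OF that] assms(1) by auto
  ultimately show thesis using that path_index_coloring[OF S _ f] by blast
qed

theorem theorem5p5:
  fixes r n :: nat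
  assumes "r \<ge> 1" and "n \<ge> 1"
  shows "set_parity_number r (path_graph n) = r * parity_number (path_graph n)"
proof (rule antisym)
  let ?G = "path_graph n"
  have "\<exists>c :: nat set \<Rightarrow> nat. parity_edge_coloring ?G c \<and> card (c ` edges ?G) = parity_number ?G"
    unfolding parity_number_def
    by (rule LeastI_ex) (use parity_edge_coloring_path_graph_Min in blast)
  then obtain c :: "nat set \<Rightarrow> nat" where c: "parity_edge_coloring ?G c"
    and card_c: "card (c ` edges ?G) = parity_number ?G" by blast
  let ?S = "\<lambda>e. {r * c e..<r * c e + r}"
  have blow: "parity_set_edge_coloring r ?G ?S" by (rule blow_up_coloring[OF c])
  then have "set_parity_number r ?G \<le> card (\<Union>e\<in>edges ?G. ?S e)"
    unfolding set_parity_number_def by (intro Least_le) blast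
  also have "(\<Union>e\<in>edges ?G. ?S e) = (\<Union>k\<in>c ` edges ?G. {r * k..<r * k + r})" by simp
  also have "card \<dots> \<le> (\<Sum>k\<in>c ` edges ?G. card {r * k..<r * k + r})"
    using finite_edges_path_graph by (intro card_UN_le) auto
  also have "\<dots> = r * parity_number ?G" using card_c by simp
  finally show "set_parity_number r ?G \<le> r * parity_number ?G" .

  \<comment> \<open>The blow-up \<open>?S\<close> guarantees that an optimal set colouring
    exists.\<close>
  have "\<exists>S :: nat set \<Rightarrow> nat set. parity_set_edge_coloring r ?G S \<and>
      card (\<Union>e\<in>edges ?G. S e) = set_parity_number r ?G"
    unfolding set_parity_number_def by (rule LeastI_ex) (use blow in blast)
  then obtain S :: "nat set \<Rightarrow> nat set" where S: "parity_set_edge_coloring r ?G S"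
    and card_S: "card (\<Union>e\<in>edges ?G. S e) = set_parity_number r ?G" by blast
  obtain d :: "nat set \<Rightarrow> nat" where d: "parity_edge_coloring ?G d"
    and le: "r * card (d ` edges ?G) \<le> set_parity_number r ?G"
    using set_coloring_lower_bound[OF assms(1) S] card_S by metis
  have "parity_number ?G \<le> card (d ` edges ?G)"
    unfolding parity_number_def using d by (intro Least_le) blast
  then show "r * parity_number ?G \<le> set_parity_number r ?G"
    using le by (meson mult_le_mono2 order_trans)
qed

end
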